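(* Let $\psi$ be holomorphic on $\mathbb{D}^n$. The following are equivalent: (a) $M_\psi$ is bounded on $\mathcal{B}(\mathbb{D}^n)$; (b) $M_\psi$ is bounded on $\mathcal{B}_{0^*}(\mathbb{D}^n)$; (c) $\psi\in H^\infty(\mathbb{D}^n)$ and $\sup_{z\in\mathbb{D}^n}\sum_{k=1}^n\log\frac{1+|z_k|}{1-|z_k|}\,Q_\psi(z)<\infty$.
   Context: $\mathbb{D}^n$ is the unit polydisk in $\mathbb{C}^n$, with Bergman metric $H_z(u,\bar u)=\sum_{k=1}^n\frac{|u_k|^2}{(1-|z_k|^2)^2}$. For $f$ holomorphic on $\mathbb{D}^n$, $Q_f(z)=\sup_{u\ne0}\frac{|\sum_j\frac{\partial f}{\partial z_j}(z)u_j|}{H_z(u,\bar u)^{1/2}}$, $\beta_f=\sup_zQ_f(z)$; $\mathcal{B}(\mathbb{D}^n)=\{f:\beta_f<\infty\}$ with norm $|f(0)|+\beta_f$; $\mathcal{B}_{0^*}(\mathbb{D}^n)=\{f\in\mathcal{B}(\mathbb{D}^n):\lim_{z\to\partial^*\mathbb{D}^n}Q_f(z)=0\}$, where $\partial^*\mathbb{D}^n=\mathbb{T}^n$ is the distinguished boundary. $H^\infty(\mathbb{D}^n)$ is the set of bounded holomorphic functions, and $M_\psi f=\psi f$. *)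

theory Defs
  imports "HOL-Analysis.Analysis"
begin

definition polydisk :: "(complex ^ 'n) set" where
  "polydisk = {z. \<forall>k. cmod (z $ k) < 1}"

definition dist_boundary :: "(complex ^ 'n) set" where
  "dist_boundary = {z. \<forall>k. cmod (z $ k) = 1}"

definition holo_polydisk :: "(complex ^ 'n \<Rightarrow> complex) \<Rightarrow> bool" where
  "holo_polydisk f \<longleftrightarrow> (\<forall>z\<in>polydisk. \<exists>D. (f has_derivative D) (at z) \<and>
        (\<forall>c u. D (c *s u) = c * D u))"

definition partial :: "'n \<Rightarrow> (complex ^ 'n \<Rightarrow> complex) \<Rightarrow> complex ^ 'n \<Rightarrow> complex" where
  "partial j f z = deriv (\<lambda>w. f (\<chi> i. if i = j then w else z $ i)) (z $ j)"

definition bergman_H :: "complex ^ 'n \<Rightarrow> complex ^ 'n \<Rightarrow> real" where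
  "bergman_H z u = (\<Sum>k\<in>UNIV. (cmod (u $ k))\<^sup>2 / (1 - (cmod (z $ k))\<^sup>2)\<^sup>2)"

definition Qf :: "(complex ^ 'n \<Rightarrow> complex) \<Rightarrow> complex ^ 'n \<Rightarrow> real" where
  "Qf f z = (SUP u\<in>{u. u \<noteq> 0}. cmod (\<Sum>j\<in>UNIV. partial j f z * u $ j) / sqrt (bergman_H z u))"

definition bloch :: "(complex ^ 'n \<Rightarrow> complex) set" where
  "bloch = {f. holo_polydisk f \<and> bdd_above (Qf f ` polydisk)}"

definition beta :: "(complex ^ 'n \<Rightarrow> complex) \<Rightarrow> real" where
  "beta f = (SUP z\<in>polydisk. Qf f z)"

definition bloch_norm :: "(complex ^ 'n \<Rightarrow> complex) \<Rightarrow> real" where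
  "bloch_norm f = cmod (f 0) + beta f"

definition bloch0 :: "(complex ^ 'n \<Rightarrow> complex) set" where
  "bloch0 = {f. f \<in> bloch \<and> (\<forall>\<epsilon>>0. \<exists>\<delta>>0. \<forall>z\<in>polydisk.
        infdist z dist_boundary < \<delta> \<longrightarrow> Qf f z < \<epsilon>)}"

definition Hinf :: "(complex ^ 'n \<Rightarrow> complex) set" where
  "Hinf = {f. holo_polydisk f \<and> bounded (f ` polydisk)}"

definition mult_bounded_on :: "(complex ^ 'n \<Rightarrow> complex) \<Rightarrow> (complex ^ 'n \<Rightarrow> complex) set \<Rightarrow> bool" where
  "mult_bounded_on \<psi> X \<longleftrightarrow> (\<forall>f\<in>X. (\<lambda>z. \<psi> z * f z) \<in> X) \<and>
      (\<exists>C. \<forall>f\<in>X. bloch_norm (\<lambda>z. \<psi> z * f z) \<le> C * bloch_norm f)"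

end

theory Submission
  imports Defs "HOL-Complex_Analysis.Cauchy_Integral_Formula"
begin

text \<open>By Cauchy--Schwarz, \<open>Qf f z\<close> is the Euclidean norm of the vector with entries
  $(1-|z_k|^2)\,\partial_k f(z)$, so the product rule gives
  $Q_{\psi f} \le |\psi| Q_f + |f| Q_\psi$ and a matching lower bound. Integrating along $t \mapsto tz$
  gives $|f(z)| \le |f(0)| + \beta_f \Lambda(z)$ with $\Lambda(z) = \sum_k \log\frac{1+|z_k|}{1-|z_k|}$;
  if $f$ is in the \<open>bloch0\<close> space, $\beta_f$ can be replaced by any $\varepsilon > 0$ near the
  distinguished boundary at the price of a larger additive constant. This gives sufficiency.
  For necessity, iterating the operator on the constant $1$ bounds $\psi$, and the functions
  $-\log(1-\bar a z_k)$, which lie in the \<open>bloch0\<close> space with norm at most $2$, tested at points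
  with $z_k = a$, bound $\Lambda Q_\psi$.\<close>

section \<open>Complex differentiability and partial derivatives on the polydisk\<close>

text \<open>Links the two notions of derivative in use: \<open>partial\<close> is a one-variable
  \<open>deriv\<close> along a coordinate slice, while \<open>holo_polydisk\<close> asks for a
  complex-linear total derivative. The slice is an affine map with direction
  \<open>axis j 1\<close>, so the chain rule applies.\<close>

lemma partial_eqI:
  fixes f :: "complex ^ 'n \<Rightarrow> complex"
  assumes D: "(f has_derivative D) (at z)" and lin: "\<And>c u. D (c *s u) = c * D u"
  shows "((\<lambda>w. f (\<chi> i. if i = j then w else z $ i)) has_field_derivative D (axis j 1)) (at (z $ j))"
    and "partial j f z = D (axis j 1)"
proof -
  let ?h = "\<lambda>w. \<chi> i. if i = j then w else z $ i"
  have hz: "?h (z $ j) = z"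
    by (simp add: vec_eq_iff)
  have "bounded_linear (\<lambda>w. w *s axis j 1 :: complex ^ 'n)"
    unfolding linear_conv_bounded_linear[symmetric]
    by (rule linearI) (simp_all add: vec_eq_iff algebra_simps)
  then have "((\<lambda>w. (\<chi> i. if i = j then 0 else z $ i) + w *s axis j 1) has_derivative (\<lambda>w. w *s axis j 1)) (at (z $ j))"
    by (auto intro!: derivative_eq_intros bounded_linear_imp_has_derivative)
  moreover have "(\<lambda>w. (\<chi> i. if i = j then 0 else z $ i) + w *s axis j 1) = ?h"
    by (auto simp: vec_eq_iff axis_def fun_eq_iff)
  ultimately have "(?h has_derivative (\<lambda>w. w *s axis j 1)) (at (z $ j))"
    by simp
  moreover have "(f has_derivative D) (at (?h (z $ j)))"
    using D hz by simp
  ultimately have "((\<lambda>w. f (?h w)) has_derivative (\<lambda>w. D (w *s axis j 1))) (at (z $ j))"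
    by (rule has_derivative_compose)
  then show 1: "((\<lambda>w. f (?h w)) has_field_derivative D (axis j 1)) (at (z $ j))"
    by (simp add: has_field_derivative_def lin mult.commute[of _ "D (axis j 1)"])
  then show "partial j f z = D (axis j 1)"
    unfolding partial_def by (rule DERIV_imp_deriv)
qed

text \<open>Complex linearity lets \<open>D\<close> be evaluated on the standard basis expansion of
  \<open>u\<close>.\<close>

lemma holo_polydisk_has_derivative:
  assumes "holo_polydisk f" "z \<in> polydisk"
  shows "(f has_derivative (\<lambda>u. \<Sum>j\<in>UNIV. partial j f z * u $ j)) (at z)"
proof -
  obtain D where D: "(f has_derivative D) (at z)" and lin: "\<And>c u. D (c *s u) = c * D u"
    using assms unfolding holo_polydisk_def by blast
  interpret D: linear D
    using D by (rule has_derivative_linear)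
  have "D u = (\<Sum>j\<in>UNIV. partial j f z * u $ j)" for u
  proof -
    have "D u = D (\<Sum>j\<in>UNIV. u $ j *s axis j 1)"
      by (simp only: basis_expansion)
    also have "\<dots> = (\<Sum>j\<in>UNIV. partial j f z * u $ j)"
      by (simp add: D.sum lin partial_eqI(2)[OF D lin] mult.commute)
    finally show ?thesis .
  qed
  then have "D = (\<lambda>u. \<Sum>j\<in>UNIV. partial j f z * u $ j)"
    by blast
  then show ?thesis using D by simp
qed

lemma holo_polydisk_partial:
  assumes "holo_polydisk f" "z \<in> polydisk"
  shows "((\<lambda>w. f (\<chi> i. if i = j then w else z $ i)) has_field_derivative partial j f z) (at (z $ j))"
proof -
  obtain D where D: "(f has_derivative D) (at z)" and lin: "\<And>c u. D (c *s u) = c * D u"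
    using assms unfolding holo_polydisk_def by blast
  show ?thesis
    unfolding partial_eqI(2)[OF D lin] by (rule partial_eqI(1)[OF D lin])
qed

lemma holo_polydisk_mult:
  assumes "holo_polydisk f" "holo_polydisk g"
  shows "holo_polydisk (\<lambda>z. f z * g z)"
  unfolding holo_polydisk_def
proof (intro ballI exI conjI allI)
  fix z :: "complex ^ 'a" assume z: "z \<in> polydisk"
  note [derivative_intros] = assms[THEN holo_polydisk_has_derivative, OF z]
  show "((\<lambda>z. f z * g z) has_derivative
      (\<lambda>u. f z * (\<Sum>j\<in>UNIV. partial j g z * u $ j) + (\<Sum>j\<in>UNIV. partial j f z * u $ j) * g z)) (at z)"
    by (auto intro!: derivative_eq_intros)
  show "f z * (\<Sum>j\<in>UNIV. partial j g z * (c *s u) $ j) + (\<Sum>j\<in>UNIV. partial j f z * (c *s u) $ j) * g z =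
      c * (f z * (\<Sum>j\<in>UNIV. partial j g z * u $ j) + (\<Sum>j\<in>UNIV. partial j f z * u $ j) * g z)" for c u
    by (simp add: sum_distrib_left sum_distrib_right algebra_simps)
qed

lemma partial_mult:
  assumes "holo_polydisk f" "holo_polydisk g" "z \<in> polydisk"
  shows "partial j (\<lambda>z. f z * g z) z = f z * partial j g z + g z * partial j f z"
proof -
  have *: "(\<chi> i. if i = j then z $ j else z $ i) = z"
    by (simp add: vec_eq_iff)
  have "((\<lambda>w. f (\<chi> i. if i = j then w else z $ i) * g (\<chi> i. if i = j then w else z $ i))
      has_field_derivative partial j f z * g z + partial j g z * f z) (at (z $ j))"
    using DERIV_mult[OF holo_polydisk_partial holo_polydisk_partial, OF assms(1,3) assms(2,3), of j]
    by (simp add: *)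
  then show ?thesis
    unfolding partial_def[of j "\<lambda>z. f z * g z"] by (simp add: DERIV_imp_deriv algebra_simps)
qed

section \<open>The supremum \<open>Qf\<close> as a Euclidean norm, and the product rule\<close>

text \<open>The differential of \<open>f\<close> in coordinates that are orthonormal for the Bergman
  metric at \<open>z\<close>; its Euclidean norm is the dual norm, hence
  \<open>Qf f z\<close>.\<close>

definition weighted_grad :: "(complex ^ 'n \<Rightarrow> complex) \<Rightarrow> complex ^ 'n \<Rightarrow> complex ^ 'n" where
  "weighted_grad f z = (\<chi> k. of_real (1 - (cmod (z $ k))\<^sup>2) * partial k f z)"

lemma polydisk_weight_pos:
  assumes "z \<in> polydisk"
  shows "0 < 1 - (cmod (z $ k))\<^sup>2"
proof -
  have "cmod (z $ k) < 1"
    using assms by (simp add: polydisk_def)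
  then show ?thesis
    by (simp add: abs_square_less_1)
qed

lemma sqrt_bergman_H:
  "sqrt (bergman_H z u) = L2_set (\<lambda>k. cmod (u $ k) / (1 - (cmod (z $ k))\<^sup>2)) UNIV"
  by (simp add: bergman_H_def L2_set_def power_divide)

lemma derivative_le_weighted_grad:
  fixes z :: "complex ^ 'n"
  assumes z: "z \<in> polydisk"
  shows "cmod (\<Sum>j\<in>UNIV. partial j f z * u $ j) \<le> norm (weighted_grad f z) * sqrt (bergman_H z u)"
proof -
  define s where "s k = 1 - (cmod (z $ k))\<^sup>2" for k
  have s: "s k > 0" for k
    using polydisk_weight_pos[OF z] by (simp add: s_def)
  have "cmod (\<Sum>j\<in>UNIV. partial j f z * u $ j) \<le> (\<Sum>j\<in>UNIV. cmod (partial j f z * u $ j))"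
    by (rule norm_sum)
  also have "\<dots> = (\<Sum>j\<in>UNIV. \<bar>cmod (weighted_grad f z $ j)\<bar> * \<bar>cmod (u $ j) / s j\<bar>)"
    using s by (intro sum.cong) (auto simp: weighted_grad_def norm_mult simp flip: s_def,
      smt (verit, best) nonzero_mult_div_cancel_left times_divide_eq_left mult.commute norm_of_real abs_of_pos mult.assoc)
  also have "\<dots> \<le> norm (weighted_grad f z) * L2_set (\<lambda>j. cmod (u $ j) / s j) UNIV"
    unfolding norm_vec_def by (rule L2_set_mult_ineq)
  finally show ?thesis
    by (simp add: sqrt_bergman_H s_def)
qed

lemma Qf_eq_norm_weighted_grad:
  fixes z :: "complex ^ 'n"
  assumes z: "z \<in> polydisk"
  shows "Qf f z = norm (weighted_grad f z)"
  unfolding Qf_def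
proof (rule cSup_eq_maximum)
  define s where "s k = 1 - (cmod (z $ k))\<^sup>2" for k
  have s: "s k > 0" for k
    using polydisk_weight_pos[OF z] by (simp add: s_def)
  let ?R = "\<lambda>u. cmod (\<Sum>j\<in>UNIV. partial j f z * u $ j) / sqrt (bergman_H z u)"
  have Hpos: "sqrt (bergman_H z u) > 0" if u: "u \<noteq> 0" for u
  proof -
    obtain k where "u $ k \<noteq> 0"
      using u by (metis vec_eq_iff zero_index)
    then have "0 < (cmod (u $ k))\<^sup>2 / (s k)\<^sup>2"
      using s[of k] by simp
    then have "0 < bergman_H z u"
      unfolding bergman_H_def s_def by (intro sum_pos2[where i=k]) auto
    then show ?thesis by simp
  qed
  show "x \<le> norm (weighted_grad f z)" if "x \<in> ?R ` {u. u \<noteq> 0}" for x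
    using that Hpos derivative_le_weighted_grad[OF z, of f] by (auto simp: divide_simps)
  show "norm (weighted_grad f z) \<in> ?R ` {u. u \<noteq> 0}"
  proof (cases "weighted_grad f z = 0")
    \<comment> \<open>The maximiser of the other case would be the excluded vector 0 here; any
      nonzero vector gives the value 0 instead.\<close>
    case True
    have "(\<chi> k. 1) \<noteq> (0 :: complex ^ 'n)"
      by (simp add: vec_eq_iff)
    moreover have "?R (\<chi> k. 1) = 0"
      using derivative_le_weighted_grad[OF z, of f "\<chi> k. 1"] True by simp
    ultimately show ?thesis
      using True by (intro image_eqI[where x="\<chi> k. 1"]) auto
  next
    case False
    define g where "g = weighted_grad f z"
    \<comment> \<open>The equality case of Cauchy-Schwarz: this vector has Bergman length
      \<open>norm g\<close>, and the differential sends it to the square of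
      \<open>norm g\<close>.\<close>
    define u where "u = (\<chi> k. of_real (s k) * cnj (g $ k))"
    have "u \<noteq> 0"
      using False s unfolding u_def g_def[symmetric] by (auto simp: vec_eq_iff) (metis less_irrefl)
    moreover have "sqrt (bergman_H z u) = norm g"
    proof -
      have "cmod (u $ k) / s k = cmod (g $ k)" for k
        using s[of k] by (simp add: u_def norm_mult)
      then show ?thesis
        by (simp add: sqrt_bergman_H norm_vec_def flip: s_def)
    qed
    moreover have "(\<Sum>j\<in>UNIV. partial j f z * u $ j) = of_real ((norm g)\<^sup>2)"
    proof -
      have "partial j f z * u $ j = of_real ((cmod (g $ j))\<^sup>2)" for j
        unfolding complex_norm_square by (simp add: u_def g_def weighted_grad_def s_def)
      then show ?thesis
        by (simp add: norm_vec_def L2_set_def sum_nonneg)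
    qed
    ultimately show ?thesis
      using False by (intro image_eqI[where x=u]) (auto simp: g_def norm_power power2_eq_square norm_mult)
  qed
qed

lemma Qf_nonneg: "z \<in> polydisk \<Longrightarrow> 0 \<le> Qf f z"
  by (simp add: Qf_eq_norm_weighted_grad)

lemma norm_vector_scalar_mult: "norm (c *s v) = cmod c * norm v" for v :: "complex ^ 'n"
  by (simp add: norm_vec_def norm_mult L2_set_right_distrib)

lemma weighted_grad_mult:
  assumes "holo_polydisk f" "holo_polydisk g" "z \<in> polydisk"
  shows "weighted_grad (\<lambda>z. f z * g z) z = f z *s weighted_grad g z + g z *s weighted_grad f z"
  by (simp add: vec_eq_iff weighted_grad_def partial_mult[OF assms] algebra_simps)

lemma Qf_mult_le:
  assumes "holo_polydisk f" "holo_polydisk g" "z \<in> polydisk"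
  shows "Qf (\<lambda>z. f z * g z) z \<le> cmod (f z) * Qf g z + cmod (g z) * Qf f z"
  unfolding Qf_eq_norm_weighted_grad[OF assms(3)] weighted_grad_mult[OF assms]
  by (rule order_trans[OF norm_triangle_ineq]) (simp add: norm_vector_scalar_mult)

text \<open>The product rule solved for one summand; it serves to isolate \<open>Qf\<close> of the
  symbol when \<open>g\<close> is a test function.\<close>

lemma Qf_mult_ge:
  assumes "holo_polydisk f" "holo_polydisk g" "z \<in> polydisk"
  shows "cmod (g z) * Qf f z \<le> Qf (\<lambda>z. f z * g z) z + cmod (f z) * Qf g z"
  unfolding Qf_eq_norm_weighted_grad[OF assms(3)] weighted_grad_mult[OF assms]
  using norm_triangle_ineq4[of "f z *s weighted_grad g z + g z *s weighted_grad f z" "f z *s weighted_grad g z"]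
  by (simp add: norm_vector_scalar_mult)

lemma holo_polydisk_const: "holo_polydisk (\<lambda>_. c)"
  unfolding holo_polydisk_def by (auto intro!: exI[where x="\<lambda>_. 0"])

lemma Qf_const: "z \<in> polydisk \<Longrightarrow> Qf (\<lambda>_. c) z = 0"
  by (simp add: Qf_eq_norm_weighted_grad weighted_grad_def partial_def zero_vec_def[symmetric])

section \<open>Growth along rays and the Cauchy estimate\<close>

lemma scaleR_polydisk:
  assumes "z \<in> polydisk" "0 \<le> t" "t \<le> 1"
  shows "t *\<^sub>R z \<in> polydisk"
proof -
  have "t * cmod (z $ k) < 1" for k
    using assms mult_left_le_one_le[of "cmod (z $ k)" t] by (force simp: polydisk_def intro: le_less_trans)
  then show ?thesis
    using assms by (simp add: polydisk_def)
qed

text \<open>Each summand is 2 artanh \<open>cmod (z $ k)\<close>, twice the distance from 0 to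
  \<open>z $ k\<close> in the disk for the metric |du|/(1-|w|^2).\<close>

definition log_sum :: "complex ^ 'n \<Rightarrow> real" where
  "log_sum z = (\<Sum>k\<in>UNIV. ln ((1 + cmod (z $ k)) / (1 - cmod (z $ k))))"

lemma log_sum_0 [simp]: "log_sum 0 = 0"
  by (simp add: log_sum_def)

lemma ln_ratio_nonneg: "0 \<le> r \<Longrightarrow> r < 1 \<Longrightarrow> 0 \<le> ln ((1 + r) / (1 - r))" for r :: real
  by (rule ln_ge_zero) (simp add: field_simps)

lemma log_sum_nonneg: "z \<in> polydisk \<Longrightarrow> 0 \<le> log_sum z"
  unfolding log_sum_def polydisk_def by (auto intro!: sum_nonneg ln_ratio_nonneg)

text \<open>The speed of $t \mapsto tz$ in the Bergman metric is at most $\sum_k |z_k|/(1 - t^2|z_k|^2)$,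
  which is the derivative of half the logarithmic sum.\<close>

lemma growth_along_ray:
  fixes z :: "complex ^ 'n"
  assumes f: "holo_polydisk f" and z: "z \<in> polydisk" and a: "0 \<le> a" "a < 1" and e: "0 \<le> e"
    and Q: "\<And>t. a < t \<Longrightarrow> t < 1 \<Longrightarrow> Qf f (t *\<^sub>R z) \<le> e"
  shows "cmod (f z - f (a *\<^sub>R z)) \<le> e / 2 * (log_sum z - log_sum (a *\<^sub>R z))"
proof -
  define r where "r k = cmod (z $ k)" for k
  \<comment> \<open>Agrees with \<open>log_sum (t *\<^sub>R z)\<close> on [0,1], but uses
    \<open>t\<close> instead of its absolute value and so has a two-sided derivative at
    \<open>t = 0\<close> as well.\<close>
  define L where "L t = (\<Sum>k\<in>UNIV. ln (1 + t * r k) - ln (1 - t * r k))" for t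
  define g where "g t = (\<Sum>j\<in>UNIV. partial j f (t *\<^sub>R z) * z $ j)" for t
  have r: "0 \<le> t * r k" "t * r k < 1" if "0 \<le> t" "t \<le> 1" for t k
    using scaleR_polydisk[OF z that] that by (auto simp: polydisk_def r_def)
  have L: "L t = log_sum (t *\<^sub>R z)" if "0 \<le> t" "t \<le> 1" for t
    unfolding L_def log_sum_def
  proof (intro sum.cong refl)
    fix k
    have "1 + t * r k > 0" "1 - t * r k > 0"
      using r[OF that, of k] by auto
    then show "ln (1 + t * r k) - ln (1 - t * r k) =
        ln ((1 + cmod ((t *\<^sub>R z) $ k)) / (1 - cmod ((t *\<^sub>R z) $ k)))"
      using that by (simp add: ln_div r_def)
  qed
  have df: "((\<lambda>t. f (t *\<^sub>R z)) has_vector_derivative g t) (at t)" if "0 \<le> t" "t \<le> 1" for t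
  proof -
    have "((\<lambda>t. t *\<^sub>R z) has_derivative (\<lambda>s. s *\<^sub>R z)) (at t)"
      by (auto intro!: derivative_eq_intros)
    from has_derivative_compose[OF this holo_polydisk_has_derivative[OF f scaleR_polydisk[OF z that]]]
    show ?thesis
      by (simp add: has_vector_derivative_def g_def scaleR_sum_right)
  qed
  have dL: "((\<lambda>t. e / 2 * L t) has_vector_derivative (e * (\<Sum>k\<in>UNIV. r k / (1 - (t * r k)\<^sup>2)))) (at t)"
    if t: "0 \<le> t" "t \<le> 1" for t
  proof -
    have "((\<lambda>t. ln (1 + t * r k) - ln (1 - t * r k)) has_real_derivative 2 * (r k / (1 - (t * r k)\<^sup>2))) (at t)" for k
    proof -
      have "1 - (t * r k)\<^sup>2 = (1 + t * r k) * (1 - t * r k)"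
        by (simp add: algebra_simps power2_eq_square)
      moreover have "1 + t * r k > 0" "1 - t * r k > 0"
        using r[OF t, of k] by auto
      ultimately have "r k / (1 + t * r k) + r k / (1 - t * r k) = 2 * (r k / (1 - (t * r k)\<^sup>2))"
        by (simp add: add_frac_eq) (simp add: algebra_simps)
      then show ?thesis
        using r[OF t, of k] by (auto intro!: derivative_eq_intros simp: field_simps)
    qed
    then have "(L has_real_derivative (\<Sum>k\<in>UNIV. 2 * (r k / (1 - (t * r k)\<^sup>2)))) (at t)"
      unfolding L_def by (intro DERIV_sum)
    then have "((\<lambda>t. e / 2 * L t) has_real_derivative e / 2 * (\<Sum>k\<in>UNIV. 2 * (r k / (1 - (t * r k)\<^sup>2)))) (at t)"
      by (rule DERIV_cmult)
    then show ?thesis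
      unfolding has_real_derivative_iff_has_vector_derivative sum_distrib_left[symmetric] by simp
  qed
  have bound: "cmod (g t) \<le> e * (\<Sum>k\<in>UNIV. r k / (1 - (t * r k)\<^sup>2))" if t: "a < t" "t < 1" for t
  proof -
    have t': "0 \<le> t" "t \<le> 1" using t a by auto
    note tz = scaleR_polydisk[OF z t']
    have pos: "0 < 1 - (t * r k)\<^sup>2" for k
      using polydisk_weight_pos[OF tz, of k] t' by (simp add: r_def)
    have "cmod (g t) \<le> Qf f (t *\<^sub>R z) * sqrt (bergman_H (t *\<^sub>R z) z)"
      unfolding g_def Qf_eq_norm_weighted_grad[OF tz] by (rule derivative_le_weighted_grad[OF tz])
    also have "\<dots> \<le> e * sqrt (bergman_H (t *\<^sub>R z) z)"
      using Q[OF t] by (intro mult_right_mono) (auto simp: sqrt_bergman_H)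
    also have "sqrt (bergman_H (t *\<^sub>R z) z) = L2_set (\<lambda>k. r k / (1 - (t * r k)\<^sup>2)) UNIV"
      using t' by (simp add: sqrt_bergman_H r_def)
    also have "e * \<dots> \<le> e * (\<Sum>k\<in>UNIV. r k / (1 - (t * r k)\<^sup>2))"
      using pos e by (intro mult_left_mono L2_set_le_sum divide_nonneg_pos) (auto simp: r_def)
    finally show ?thesis .
  qed
  have "cmod (f (1 *\<^sub>R z) - f (a *\<^sub>R z)) \<le> e / 2 * L 1 - e / 2 * L a"
  proof (rule differentiable_bound_general[OF a(2), where f' = g and \<phi>' = "\<lambda>t. e * (\<Sum>k\<in>UNIV. r k / (1 - (t * r k)\<^sup>2))"])
    show "continuous_on {a..1} (\<lambda>t. f (t *\<^sub>R z))"
      using a by (intro continuous_at_imp_continuous_on ballI has_vector_derivative_continuous[OF df]) auto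
    show "continuous_on {a..1} (\<lambda>t. e / 2 * L t)"
      using a by (intro continuous_at_imp_continuous_on ballI has_vector_derivative_continuous[OF dL]) auto
    show "((\<lambda>t. e / 2 * L t) has_vector_derivative e * (\<Sum>k\<in>UNIV. r k / (1 - (t * r k)\<^sup>2))) (at t)"
      if "a < t" "t < 1" for t
      using that a by (intro dL) auto
  qed (use a in \<open>auto intro!: df bound\<close>)
  then show ?thesis
    using a by (simp add: L right_diff_distrib)
qed

text \<open>Cauchy's inequality in each variable separately: the weight vanishes at the same rate as
  the available radius. The factor \<open>CARD('n)\<close> comes from bounding the Euclidean norm by
  the sum of the entries.\<close>

lemma Qf_le_of_bounded:
  fixes z :: "complex ^ 'n"
  assumes f: "holo_polydisk f" and M: "\<And>z. z \<in> polydisk \<Longrightarrow> cmod (f z) \<le> M" and z: "z \<in> polydisk"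
  shows "Qf f z \<le> 4 * M * CARD('n)"
proof -
  have "norm (weighted_grad f z $ k) \<le> 4 * M" for k
  proof -
    \<comment> \<open>Half the distance to the unit circle, so that the closed disk of radius
      \<open>r\<close> around \<open>z $ k\<close> stays in the open unit disk.\<close>
    define r where "r = (1 - cmod (z $ k)) / 2"
    have zk: "cmod (z $ k) < 1" using z by (simp add: polydisk_def)
    then have r: "r > 0" by (simp add: r_def)
    let ?h = "\<lambda>w. f (\<chi> i. if i = k then w else z $ i)"
    have disk: "(\<chi> i. if i = k then w else z $ i) \<in> polydisk" if "w \<in> cball (z $ k) r" for w
    proof -
      have "cmod w \<le> cmod (z $ k) + r"
        using that norm_triangle_ineq2[of w "z $ k"] by (simp add: dist_norm norm_minus_commute)
      also have "\<dots> < 1" using zk by (simp add: r_def field_simps)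
      finally show ?thesis using z by (simp add: polydisk_def)
    qed
    \<comment> \<open>Overwriting the \<open>k\<close>-th coordinate twice is the same as
      overwriting it once, so all these points share the slice \<open>?h\<close>.\<close>
    have D: "(?h has_field_derivative partial k f (\<chi> i. if i = k then w else z $ i)) (at w)"
      if "w \<in> cball (z $ k) r" for w
      using holo_polydisk_partial[OF f disk[OF that], of k] by (simp cong: if_cong)
    have "cmod ((deriv ^^ 1) ?h (z $ k)) \<le> fact 1 * M / r ^ 1"
    proof (rule Cauchy_inequality[OF _ _ r])
      show "?h holomorphic_on ball (z $ k) r"
        using D ball_subset_cball by (auto intro!: holomorphic_onI simp: field_differentiable_def
          intro: has_field_derivative_at_within) (meson D has_field_derivative_at_within less_imp_le mem_cball)
      show "continuous_on (cball (z $ k) r) ?h"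
        using D by (intro continuous_at_imp_continuous_on ballI DERIV_isCont)
      show "cmod (?h x) \<le> M" if "cmod (z $ k - x) = r" for x
        using that by (intro M disk) (simp add: dist_norm)
    qed
    then have "cmod (partial k f z) \<le> M / r"
      by (simp add: partial_def)
    \<comment> \<open>With x = \<open>cmod (z $ k)\<close>, 1 - x^2 is at most 2(1 - x), because (1
      - x)^2 is nonnegative.\<close>
    moreover have "1 - (cmod (z $ k))\<^sup>2 \<le> 4 * r"
      using zero_le_power2[of "1 - cmod (z $ k)"] by (simp add: r_def power2_eq_square algebra_simps)
    moreover have "0 \<le> M / r"
      using calculation(1) norm_ge_zero order_trans by blast
    ultimately have "(1 - (cmod (z $ k))\<^sup>2) * cmod (partial k f z) \<le> 4 * r * (M / r)"
      using polydisk_weight_pos[OF z, of k] r by (intro mult_mono) auto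
    then show ?thesis
      using r polydisk_weight_pos[OF z, of k] by (simp add: weighted_grad_def norm_mult abs_of_pos del: of_real_diff of_real_power)
  qed
  then have "(\<Sum>k\<in>UNIV. norm (weighted_grad f z $ k)) \<le> (\<Sum>k\<in>(UNIV::'n set). 4 * M)"
    by (intro sum_mono)
  moreover have "norm (weighted_grad f z) \<le> (\<Sum>k\<in>UNIV. norm (weighted_grad f z $ k))"
    unfolding norm_vec_def by (rule L2_set_le_sum) simp
  ultimately show ?thesis
    by (simp add: Qf_eq_norm_weighted_grad[OF z] mult.commute)
qed

section \<open>The Bloch space and its norm\<close>

lemma zero_in_polydisk: "0 \<in> polydisk"
  by (simp add: polydisk_def)

lemma Qf_le_beta: "f \<in> bloch \<Longrightarrow> z \<in> polydisk \<Longrightarrow> Qf f z \<le> beta f"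
  unfolding bloch_def beta_def by (auto intro: cSUP_upper)

lemma beta_nonneg: "f \<in> bloch \<Longrightarrow> 0 \<le> beta f"
  using Qf_nonneg[OF zero_in_polydisk] Qf_le_beta[OF _ zero_in_polydisk] by (rule order_trans)

lemma bloch_norm_nonneg: "f \<in> bloch \<Longrightarrow> 0 \<le> bloch_norm f"
  by (simp add: bloch_norm_def beta_nonneg)

lemma blochI:
  assumes "holo_polydisk f" "\<And>z. z \<in> polydisk \<Longrightarrow> Qf f z \<le> B"
  shows "f \<in> bloch" "beta f \<le> B"
  using assms zero_in_polydisk unfolding bloch_def beta_def
  by (auto intro!: cSUP_least bdd_aboveI2)

text \<open>The ray estimate started at the origin, with its factor 1/2 given away.\<close>

lemma bloch_growth:
  assumes f: "f \<in> bloch" and z: "z \<in> polydisk"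
  shows "cmod (f z) \<le> cmod (f 0) + beta f * log_sum z"
proof -
  have "cmod (f z - f (0 *\<^sub>R z)) \<le> beta f / 2 * (log_sum z - log_sum (0 *\<^sub>R z))"
    using f z by (intro growth_along_ray) (auto simp: bloch_def intro!: beta_nonneg Qf_le_beta scaleR_polydisk)
  also have "\<dots> \<le> beta f * log_sum z"
    using beta_nonneg[OF f] log_sum_nonneg[OF z] by (simp add: field_simps)
  finally show ?thesis
    using norm_triangle_ineq2[of "f z" "f 0"] by simp
qed

section \<open>Neighbourhoods of the distinguished boundary and the space
  \<open>bloch0\<close>\<close>

lemma cmod_gt_of_infdist_dist_boundary:
  assumes "infdist z dist_boundary < \<delta>"
  shows "1 - \<delta> < cmod (z $ k)"
proof -
  have ne: "dist_boundary \<noteq> {}"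
    by (auto simp: dist_boundary_def intro!: exI[where x="\<chi> k. 1"])
  have "bdd_below (dist z ` dist_boundary)"
    by (rule bdd_belowI2[where m=0]) simp
  then obtain \<zeta> where \<zeta>: "\<zeta> \<in> dist_boundary" "dist z \<zeta> < \<delta>"
    using assms cINF_less_iff[OF ne, of "dist z"] by (auto simp: infdist_notempty[OF ne])
  have "dist (z $ k) (\<zeta> $ k) < \<delta>"
    using dist_vec_nth_le[of z k \<zeta>] \<zeta>(2) by simp
  moreover have "cmod (\<zeta> $ k) = 1"
    using \<zeta>(1) by (simp add: dist_boundary_def)
  ultimately show ?thesis
    using norm_triangle_ineq2[of "\<zeta> $ k" "z $ k"] by (simp add: dist_norm norm_minus_commute)
qed

text \<open>Radial projection of every coordinate gives a nearby torus point. The bound on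
  \<open>\<delta>\<close> keeps the coordinates nonzero, so that \<open>sgn\<close> has modulus
  1.\<close>

lemma infdist_dist_boundary_le:
  fixes z :: "complex ^ 'n" and \<delta> :: real
  assumes z: "z \<in> polydisk" and \<delta>: "\<delta> \<le> 1" and near: "\<And>k. 1 - \<delta> < cmod (z $ k)"
  shows "infdist z dist_boundary \<le> CARD('n) * \<delta>"
proof (rule infdist_le2)
  have nz: "z $ k \<noteq> 0" for k
    using near[of k] \<delta> by auto
  then show "(\<chi> k. sgn (z $ k)) \<in> dist_boundary"
    by (simp add: dist_boundary_def norm_sgn)
  have "dist (z $ k) (sgn (z $ k)) \<le> \<delta>" for k
  proof -
    have "z $ k - sgn (z $ k) = (of_real (cmod (z $ k) - 1)) * sgn (z $ k)"
      using nz[of k] by (simp add: sgn_eq field_simps)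
    then have "dist (z $ k) (sgn (z $ k)) = \<bar>cmod (z $ k) - 1\<bar>"
      using nz[of k] by (simp add: dist_norm norm_mult norm_sgn del: of_real_diff)
    moreover have "cmod (z $ k) < 1" using z by (simp add: polydisk_def)
    ultimately show ?thesis using near[of k] by simp
  qed
  then have "(\<Sum>k\<in>UNIV. dist (z $ k) ((\<chi> k. sgn (z $ k)) $ k)) \<le> (\<Sum>k\<in>(UNIV::'n set). \<delta>)"
    by (intro sum_mono) simp
  moreover have "dist z (\<chi> k. sgn (z $ k)) \<le> (\<Sum>k\<in>UNIV. dist (z $ k) ((\<chi> k. sgn (z $ k)) $ k))"
    unfolding dist_vec_def by (rule L2_set_le_sum) simp
  ultimately show "dist z (\<chi> k. sgn (z $ k)) \<le> CARD('n) * \<delta>"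
    by simp
qed

lemma bloch0_subset_bloch: "bloch0 \<subseteq> bloch"
  by (auto simp: bloch0_def)

text \<open>Trades the distance to the torus for conditions on the single moduli, which are the form
  all later estimates use.\<close>

lemma bloch0_iff:
  fixes f :: "complex ^ 'n \<Rightarrow> complex"
  shows "f \<in> bloch0 \<longleftrightarrow> f \<in> bloch \<and> (\<forall>\<epsilon>>0. \<exists>\<delta>>0. \<delta> \<le> 1 \<and>
     (\<forall>z\<in>polydisk. (\<forall>k. 1 - \<delta> < cmod (z $ k)) \<longrightarrow> Qf f z < \<epsilon>))"
proof -
  have "(\<exists>\<delta>>0. \<forall>z\<in>polydisk. infdist z dist_boundary < \<delta> \<longrightarrow> Qf f z < \<epsilon>) \<longleftrightarrow>
    (\<exists>\<delta>>0. \<delta> \<le> 1 \<and> (\<forall>z\<in>polydisk. (\<forall>k. 1 - \<delta> < cmod (z $ k)) \<longrightarrow> Qf f z < \<epsilon>))"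
    (is "?L \<longleftrightarrow> ?R") for \<epsilon>
  proof
    assume ?L
    then obtain \<delta> where \<delta>: "\<delta> > 0" "\<And>z. z \<in> polydisk \<Longrightarrow> infdist z dist_boundary < \<delta> \<Longrightarrow> Qf f z < \<epsilon>"
      by blast
    \<comment> \<open>The 2 makes the resulting distance bound strict; the minimum with 1 is what
      the projection estimate requires.\<close>
    define \<eta> where "\<eta> = min 1 (\<delta> / (2 * CARD('n)))"
    have \<eta>: "\<eta> > 0" "\<eta> \<le> 1"
      using \<delta>(1) by (auto simp: \<eta>_def)
    have "\<eta> \<le> \<delta> / (2 * CARD('n))"
      by (simp add: \<eta>_def)
    then have "CARD('n) * \<eta> \<le> \<delta> / 2"
      by (simp add: field_simps)
    then have "CARD('n) * \<eta> < \<delta>"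
      using \<delta>(1) by simp
    then have "Qf f z < \<epsilon>" if "z \<in> polydisk" "\<And>k. 1 - \<eta> < cmod (z $ k)" for z
      using infdist_dist_boundary_le[OF that(1) \<eta>(2) that(2)] that(1) by (intro \<delta>(2)) auto
    then show ?R using \<eta> by blast
  next
    assume ?R
    then show ?L using cmod_gt_of_infdist_dist_boundary by blast
  qed
  then show ?thesis
    unfolding bloch0_def by simp
qed

lemma bloch0E:
  assumes "f \<in> bloch0" "\<epsilon> > 0"
  obtains \<delta> where "\<delta> > 0" "\<delta> \<le> 1" "\<And>z. z \<in> polydisk \<Longrightarrow> (\<And>k. 1 - \<delta> < cmod (z $ k)) \<Longrightarrow> Qf f z < \<epsilon>"
  using assms unfolding bloch0_iff by blast

lemma const_in_bloch0: "(\<lambda>_. c) \<in> bloch0"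
proof -
  have "(\<lambda>_. c) \<in> bloch"
    by (rule blochI(1)[OF holo_polydisk_const, of _ 0]) (simp add: Qf_const)
  then show ?thesis
    unfolding bloch0_iff by (auto simp: Qf_const intro!: exI[where x="1::real"])
qed

text \<open>The ray is cut at \<open>a *\<^sub>R z\<close>. On the outer piece \<open>Qf f\<close>
  is below \<open>e\<close>; the inner endpoint lies in a fixed smaller polydisk, where
  \<open>f\<close> is bounded by a constant independent of \<open>z\<close>.\<close>

lemma bloch0_growth:
  fixes f :: "complex ^ 'n \<Rightarrow> complex"
  assumes f: "f \<in> bloch0" and e: "e > 0"
  obtains A \<delta> where "0 \<le> A" "\<delta> > 0" "\<delta> \<le> 1"
    "\<And>z. z \<in> polydisk \<Longrightarrow> (\<And>k. 1 - \<delta> < cmod (z $ k)) \<Longrightarrow> cmod (f z) \<le> A + e * log_sum z"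
proof -
  obtain \<delta> where \<delta>: "\<delta> > 0" "\<delta> \<le> 1"
    and Q: "\<And>z. z \<in> polydisk \<Longrightarrow> (\<And>k. 1 - \<delta> < cmod (z $ k)) \<Longrightarrow> Qf f z < e"
    using bloch0E[OF f e] by metis
  have fb: "f \<in> bloch" using f by (simp add: bloch0_iff)
  define a where "a = 1 - \<delta> / 2"
  have a: "0 \<le> a" "a < 1" using \<delta> by (auto simp: a_def)
  define B where "B = CARD('n) * ln ((1 + a) / (1 - a))"
  have B: "0 \<le> B" using ln_ratio_nonneg[OF a] by (simp add: B_def)
  show ?thesis
  proof (rule that)
    show "0 \<le> cmod (f 0) + beta f * B"
      using beta_nonneg[OF fb] B by simp
    show "\<delta> / 2 > 0" "\<delta> / 2 \<le> 1" using \<delta> by auto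
    fix z :: "complex ^ 'n" assume z: "z \<in> polydisk" and near: "\<And>k. 1 - \<delta> / 2 < cmod (z $ k)"
    have az: "a *\<^sub>R z \<in> polydisk" using scaleR_polydisk[OF z] a by simp
    have "Qf f (t *\<^sub>R z) \<le> e" if t: "a < t" "t < 1" for t
    proof (intro less_imp_le Q)
      show "t *\<^sub>R z \<in> polydisk" using scaleR_polydisk[OF z] a t by simp
      fix k
      \<comment> \<open>This is why \<open>a\<close> uses half of \<open>\<delta>\<close>: both
        factors \<open>t\<close> and \<open>cmod (z $ k)\<close> exceed 1 -
        \<open>\<delta>\<close>/2, and its square exceeds 1 - \<open>\<delta>\<close>.\<close>
      have "1 - \<delta> < a * a"
        using \<delta>(1) by (simp add: a_def algebra_simps)
      also have "a * a \<le> t * cmod (z $ k)"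
        using t a near[of k] by (intro mult_mono) (auto simp: a_def)
      finally show "1 - \<delta> < cmod ((t *\<^sub>R z) $ k)" using t a by simp
    qed
    then have "cmod (f z - f (a *\<^sub>R z)) \<le> e / 2 * (log_sum z - log_sum (a *\<^sub>R z))"
      using fb e a z by (intro growth_along_ray) (auto simp: bloch_def)
    also have "\<dots> \<le> e * log_sum z"
      using log_sum_nonneg[OF z] log_sum_nonneg[OF az] e by (simp add: field_simps)
    finally have 1: "cmod (f z) \<le> cmod (f (a *\<^sub>R z)) + e * log_sum z"
      using norm_triangle_ineq2[of "f z" "f (a *\<^sub>R z)"] by simp
    have "log_sum (a *\<^sub>R z) \<le> (\<Sum>k\<in>(UNIV::'n set). ln ((1 + a) / (1 - a)))"
      unfolding log_sum_def
    proof (rule sum_mono)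
      fix k
      have "cmod ((a *\<^sub>R z) $ k) \<le> a"
        using z a by (simp add: polydisk_def mult_left_le less_imp_le)
      then show "ln ((1 + cmod ((a *\<^sub>R z) $ k)) / (1 - cmod ((a *\<^sub>R z) $ k))) \<le> ln ((1 + a) / (1 - a))"
        using a by (intro ln_mono frac_le divide_pos_pos) (auto simp: add_pos_nonneg)
    qed
    then have "log_sum (a *\<^sub>R z) \<le> B" by (simp add: B_def)
    then have "beta f * log_sum (a *\<^sub>R z) \<le> beta f * B"
      using beta_nonneg[OF fb] by (rule mult_left_mono)
    then show "cmod (f z) \<le> cmod (f 0) + beta f * B + e * log_sum z"
      using 1 bloch_growth[OF fb az] by simp
  qed
qed

section \<open>Sufficiency of the condition on the symbol\<close>

context
  fixes \<psi> :: "complex ^ 'n \<Rightarrow> complex" and M K :: real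
  assumes holo: "holo_polydisk \<psi>"
    and M: "\<And>z. z \<in> polydisk \<Longrightarrow> cmod (\<psi> z) \<le> M"
    and K: "\<And>z. z \<in> polydisk \<Longrightarrow> log_sum z * Qf \<psi> z \<le> K"
begin

private lemma M_nonneg: "0 \<le> M"
  using M[OF zero_in_polydisk] norm_ge_zero order_trans by blast

private lemma K_nonneg: "0 \<le> K"
  using K[OF zero_in_polydisk] by simp

text \<open>The logarithmic sum tends to infinity at the boundary while its product with
  \<open>Qf \<psi>\<close> stays below \<open>K\<close>, so \<open>Qf \<psi>\<close> must tend to
  0.\<close>

lemma symbol_in_bloch0: "\<psi> \<in> bloch0"
  unfolding bloch0_iff
proof (intro conjI allI impI)
  show "\<psi> \<in> bloch"
    using Qf_le_of_bounded[OF holo M] by (intro blochI(1)[OF holo])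
  fix \<epsilon> :: real assume \<epsilon>: "\<epsilon> > 0"
  \<comment> \<open>\<open>K + 1\<close> instead of \<open>K\<close> gives a strict inequality and
    keeps \<open>R\<close> positive when \<open>K\<close> is 0.\<close>
  define R where "R = (K + 1) / \<epsilon>"
  have R: "R > 0" using \<epsilon> K_nonneg by (simp add: R_def)
  have "Qf \<psi> z < \<epsilon>" if z: "z \<in> polydisk" and near: "\<And>k. 1 - exp (- R) < cmod (z $ k)" for z
  proof -
    \<comment> \<open>One arbitrary coordinate suffices: its logarithmic term alone is at least
      \<open>R\<close>.\<close>
    fix k :: 'n
    have zk: "cmod (z $ i) < 1" for i using z by (simp add: polydisk_def)
    have "R = ln (1 / exp (- R))" by (simp add: ln_div)
    also have "\<dots> \<le> ln ((1 + cmod (z $ k)) / (1 - cmod (z $ k)))"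
      using near[of k] zk[of k] by (intro ln_mono frac_le divide_pos_pos) auto
    also have "\<dots> \<le> log_sum z"
      unfolding log_sum_def using zk by (intro member_le_sum) (auto intro!: ln_ratio_nonneg)
    finally have "R * Qf \<psi> z \<le> log_sum z * Qf \<psi> z"
      using Qf_nonneg[OF z] by (rule mult_right_mono)
    also have "\<dots> < K + 1" using K[OF z] by simp
    also have "K + 1 = R * \<epsilon>" using \<epsilon> by (simp add: R_def)
    finally show ?thesis using R by simp
  qed
  then show "\<exists>\<delta>>0. \<delta> \<le> 1 \<and> (\<forall>z\<in>polydisk. (\<forall>k. 1 - \<delta> < cmod (z $ k)) \<longrightarrow> Qf \<psi> z < \<epsilon>)"
    using R by (intro exI[where x="exp (- R)"]) auto
qed

text \<open>In the product rule, \<open>K\<close> absorbs the logarithmic growth of \<open>f\<close>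
  and \<open>beta \<psi>\<close> handles the part coming from \<open>f 0\<close>. The second
  \<open>M\<close> pays for the value of the product at the origin.\<close>

lemma mult_bloch_bound:
  assumes f: "f \<in> bloch"
  shows "(\<lambda>z. \<psi> z * f z) \<in> bloch"
    and "bloch_norm (\<lambda>z. \<psi> z * f z) \<le> (2 * M + K + beta \<psi>) * bloch_norm f"
proof -
  have \<psi>: "\<psi> \<in> bloch" using symbol_in_bloch0 by (simp add: bloch0_iff)
  have hf: "holo_polydisk f" using f by (simp add: bloch_def)
  note nn = M_nonneg K_nonneg beta_nonneg[OF \<psi>] beta_nonneg[OF f]
  have Q: "Qf (\<lambda>z. \<psi> z * f z) z \<le> (M + K + beta \<psi>) * bloch_norm f" if z: "z \<in> polydisk" for z
  proof -
    have "Qf (\<lambda>z. \<psi> z * f z) z \<le> cmod (\<psi> z) * Qf f z + cmod (f z) * Qf \<psi> z"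
      by (rule Qf_mult_le[OF holo hf z])
    also have "\<dots> \<le> M * beta f + (cmod (f 0) + beta f * log_sum z) * Qf \<psi> z"
      using M[OF z] Qf_le_beta[OF f z] bloch_growth[OF f z] Qf_nonneg[OF z] nn
      by (intro add_mono mult_mono mult_right_mono) auto
    also have "\<dots> = M * beta f + cmod (f 0) * Qf \<psi> z + beta f * (log_sum z * Qf \<psi> z)"
      by (simp add: algebra_simps)
    also have "\<dots> \<le> M * beta f + cmod (f 0) * beta \<psi> + beta f * K"
      using K[OF z] Qf_le_beta[OF \<psi> z] nn by (intro add_mono mult_left_mono) auto
    also have "\<dots> \<le> (M + K + beta \<psi>) * bloch_norm f"
      using nn by (simp add: bloch_norm_def algebra_simps)
    finally show ?thesis .
  qed
  show "(\<lambda>z. \<psi> z * f z) \<in> bloch"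
    by (rule blochI(1)[OF holo_polydisk_mult[OF holo hf] Q])
  have "cmod (\<psi> 0 * f 0) \<le> M * bloch_norm f"
    unfolding norm_mult bloch_norm_def using M[OF zero_in_polydisk] nn by (intro mult_mono) auto
  moreover have "beta (\<lambda>z. \<psi> z * f z) \<le> (M + K + beta \<psi>) * bloch_norm f"
    by (rule blochI(2)[OF holo_polydisk_mult[OF holo hf] Q])
  ultimately show "bloch_norm (\<lambda>z. \<psi> z * f z) \<le> (2 * M + K + beta \<psi>) * bloch_norm f"
    unfolding bloch_norm_def[of "\<lambda>z. \<psi> z * f z"] by (simp add: algebra_simps)
qed

text \<open>Near the distinguished boundary, \<open>Qf \<psi>\<close> is small and \<open>f\<close> is bounded up to a small
  multiple of the logarithmic sum, whose product with \<open>Qf \<psi>\<close> stays bounded.\<close>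

lemma mult_in_bloch0:
  assumes f: "f \<in> bloch0"
  shows "(\<lambda>z. \<psi> z * f z) \<in> bloch0"
  unfolding bloch0_iff
proof (intro conjI allI impI)
  have fb: "f \<in> bloch" using f by (simp add: bloch0_iff)
  have hf: "holo_polydisk f" using fb by (simp add: bloch_def)
  show "(\<lambda>z. \<psi> z * f z) \<in> bloch" by (rule mult_bloch_bound(1)[OF fb])
  fix \<epsilon> :: real assume \<epsilon>: "\<epsilon> > 0"
  \<comment> \<open>Three errors \<open>M * e\<close>, \<open>e\<close> and \<open>e * K\<close>
    will arise; they add up to \<open>\<epsilon>\<close>/3.\<close>
  define e where "e = \<epsilon> / (3 * (M + K + 1))"
  have e: "e > 0" using \<epsilon> M_nonneg K_nonneg by (simp add: e_def)
  have "M + K + 1 \<noteq> 0" using M_nonneg K_nonneg by simp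
  then have eq: "3 * ((M + K + 1) * e) = \<epsilon>"
    by (simp add: e_def del: distrib_left_numeral)
  obtain A \<delta>1 where A: "0 \<le> A" and \<delta>1: "\<delta>1 > 0" "\<delta>1 \<le> 1"
    and F: "\<And>z. z \<in> polydisk \<Longrightarrow> (\<And>k. 1 - \<delta>1 < cmod (z $ k)) \<Longrightarrow> cmod (f z) \<le> A + e * log_sum z"
    using bloch0_growth[OF f e] by metis
  obtain \<delta>2 where \<delta>2: "\<delta>2 > 0" "\<delta>2 \<le> 1"
    and Q1: "\<And>z. z \<in> polydisk \<Longrightarrow> (\<And>k. 1 - \<delta>2 < cmod (z $ k)) \<Longrightarrow> Qf f z < e"
    using bloch0E[OF f e] by metis
  \<comment> \<open>\<open>A + 1\<close> avoids division by zero, as \<open>A\<close> may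
    vanish.\<close>
  have "e / (A + 1) > 0" using e A by simp
  then obtain \<delta>3 where \<delta>3: "\<delta>3 > 0" "\<delta>3 \<le> 1"
    and Q2: "\<And>z. z \<in> polydisk \<Longrightarrow> (\<And>k. 1 - \<delta>3 < cmod (z $ k)) \<Longrightarrow> Qf \<psi> z < e / (A + 1)"
    using bloch0E[OF symbol_in_bloch0] by metis
  define \<delta> where "\<delta> = min \<delta>1 (min \<delta>2 \<delta>3)"
  have "Qf (\<lambda>z. \<psi> z * f z) z < \<epsilon>" if z: "z \<in> polydisk" and near: "\<And>k. 1 - \<delta> < cmod (z $ k)" for z
  proof -
    have near': "1 - \<delta>1 < cmod (z $ k)" "1 - \<delta>2 < cmod (z $ k)" "1 - \<delta>3 < cmod (z $ k)" for k
      using near[of k] by (auto simp: \<delta>_def)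
    have AQ: "A * Qf \<psi> z \<le> e"
    proof -
      have "A * Qf \<psi> z \<le> (A + 1) * (e / (A + 1))"
        using Q2[OF z near'(3)] A Qf_nonneg[OF z] by (intro mult_mono) auto
      then show ?thesis using A by simp
    qed
    have "Qf (\<lambda>z. \<psi> z * f z) z \<le> cmod (\<psi> z) * Qf f z + cmod (f z) * Qf \<psi> z"
      by (rule Qf_mult_le[OF holo hf z])
    also have "\<dots> \<le> M * e + (A + e * log_sum z) * Qf \<psi> z"
      using M[OF z] Q1[OF z near'(2)] F[OF z near'(1)] Qf_nonneg[OF z] M_nonneg
      by (intro add_mono mult_mono mult_right_mono) auto
    also have "\<dots> = M * e + A * Qf \<psi> z + e * (log_sum z * Qf \<psi> z)"
      by (simp add: algebra_simps)
    also have "\<dots> \<le> M * e + e + e * K"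
      using AQ K[OF z] e M_nonneg by (intro add_mono mult_left_mono) auto
    also have "\<dots> = (M + K + 1) * e"
      by (simp add: algebra_simps)
    also have "\<dots> < \<epsilon>" using eq \<epsilon> by linarith
    finally show ?thesis .
  qed
  moreover have "\<delta> > 0" "\<delta> \<le> 1" using \<delta>1 \<delta>2 \<delta>3 by (auto simp: \<delta>_def)
  ultimately show "\<exists>\<delta>>0. \<delta> \<le> 1 \<and> (\<forall>z\<in>polydisk. (\<forall>k. 1 - \<delta> < cmod (z $ k)) \<longrightarrow> Qf (\<lambda>z. \<psi> z * f z) z < \<epsilon>)"
    by blast
qed

lemma mult_bounded_on_bloch: "mult_bounded_on \<psi> bloch"
  unfolding mult_bounded_on_def using mult_bloch_bound by blast

lemma mult_bounded_on_bloch0: "mult_bounded_on \<psi> bloch0"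
  unfolding mult_bounded_on_def using mult_bloch_bound(2) mult_in_bloch0 bloch0_subset_bloch by blast

end

section \<open>Necessity: logarithmic test functions and powers of the symbol\<close>

text \<open>At \<open>z $ k = a\<close> the value is -ln(1-|a|^2), which grows like the
  \<open>k\<close>-th logarithmic term. It vanishes at 0, so its Bloch norm is just
  \<open>beta\<close>.\<close>

definition log_kernel :: "complex \<Rightarrow> 'n \<Rightarrow> complex ^ 'n \<Rightarrow> complex" where
  "log_kernel a k z = - Ln (1 - cnj a * z $ k)"

lemma log_kernel_0 [simp]: "log_kernel a k 0 = 0"
  by (simp add: log_kernel_def)

text \<open>The modulus of \<open>cnj a * w\<close> is at most that of either factor. Positivity
  keeps \<open>Ln\<close> off its branch cut; the lower bounds control the derivative of the
  kernel.\<close>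

lemma Re_one_minus_pos:
  assumes "cmod a < 1" "cmod w < 1"
  shows "0 < Re (1 - cnj a * w)" and "1 - cmod w \<le> cmod (1 - cnj a * w)" and "1 - cmod a \<le> cmod (1 - cnj a * w)"
proof -
  have "cmod (cnj a * w) \<le> cmod w" "cmod (cnj a * w) \<le> cmod a"
    using assms by (auto simp: norm_mult mult_left_le_one_le mult_left_le)
  then show "0 < Re (1 - cnj a * w)" "1 - cmod w \<le> cmod (1 - cnj a * w)" "1 - cmod a \<le> cmod (1 - cnj a * w)"
    using complex_Re_le_cmod[of "cnj a * w"] assms norm_triangle_ineq2[of 1 "cnj a * w"] by auto
qed

lemma log_kernel_has_derivative:
  assumes a: "cmod a < 1" and z: "z \<in> polydisk"
  shows "(log_kernel a k has_derivative (\<lambda>u. cnj a / (1 - cnj a * z $ k) * u $ k)) (at z)"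
proof -
  have "0 < Re (1 - cnj a * z $ k)"
    using Re_one_minus_pos(1)[OF a] z by (simp add: polydisk_def)
  then have "1 - cnj a * z $ k \<notin> \<real>\<^sub>\<le>\<^sub>0"
    using complex_nonpos_Reals_iff by auto
  then have "((\<lambda>w. - Ln (1 - cnj a * w)) has_field_derivative cnj a / (1 - cnj a * z $ k)) (at (z $ k))"
    by (auto intro!: derivative_eq_intros simp: divide_inverse mult.commute)
  then have D: "((\<lambda>w. - Ln (1 - cnj a * w)) has_derivative (\<lambda>h. cnj a / (1 - cnj a * z $ k) * h)) (at (z $ k))"
    by (simp only: has_field_derivative_def)
  have "((\<lambda>z. z $ k) has_derivative (\<lambda>u. u $ k)) (at z)"
    by (intro bounded_linear_imp_has_derivative bounded_linear_vec_nth)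
  from has_derivative_compose[OF this D] show ?thesis
    by (simp add: log_kernel_def[abs_def])
qed

lemma holo_log_kernel: "cmod a < 1 \<Longrightarrow> holo_polydisk (log_kernel a k)"
  unfolding holo_polydisk_def using log_kernel_has_derivative by fastforce

lemma Qf_log_kernel:
  assumes a: "cmod a < 1" and z: "z \<in> polydisk"
  shows "Qf (log_kernel a k) z = (1 - (cmod (z $ k))\<^sup>2) * (cmod a / cmod (1 - cnj a * z $ k))"
proof -
  have "partial j (log_kernel a k) z = (if j = k then cnj a / (1 - cnj a * z $ k) else 0)" for j
    by (subst partial_eqI(2)[OF log_kernel_has_derivative[OF a z]]) (auto simp: axis_def)
  then have "weighted_grad (log_kernel a k) z =
      axis k (of_real (1 - (cmod (z $ k))\<^sup>2) * (cnj a / (1 - cnj a * z $ k)))"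
    by (auto simp: vec_eq_iff weighted_grad_def axis_def)
  also have "\<dots> = (of_real (1 - (cmod (z $ k))\<^sup>2) * (cnj a / (1 - cnj a * z $ k))) *s axis k 1"
    by (simp add: vec_eq_iff axis_def)
  finally show ?thesis
    using polydisk_weight_pos[OF z, of k]
    by (simp add: norm_vector_scalar_mult Qf_eq_norm_weighted_grad[OF z] norm_mult norm_divide abs_of_pos del: of_real_diff of_real_power)
qed

text \<open>The first bound is uniform in \<open>a\<close> and gives the norm; the second, for fixed
  \<open>a\<close>, gives decay at the boundary.\<close>

lemma Qf_log_kernel_le:
  assumes a: "cmod a < 1" and z: "z \<in> polydisk"
  shows "Qf (log_kernel a k) z \<le> 2"
    and "Qf (log_kernel a k) z \<le> 2 * (1 - cmod (z $ k)) / (1 - cmod a)"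
proof -
  have zk: "cmod (z $ k) < 1" using z by (simp add: polydisk_def)
  have w: "1 - (cmod (z $ k))\<^sup>2 \<le> 2 * (1 - cmod (z $ k))"
    using zero_le_power2[of "1 - cmod (z $ k)"] by (simp add: power2_eq_square algebra_simps)
  have "cmod a / cmod (1 - cnj a * z $ k) \<le> 1 / (1 - cmod (z $ k))"
    "cmod a / cmod (1 - cnj a * z $ k) \<le> 1 / (1 - cmod a)"
    using Re_one_minus_pos[OF a zk] zk a by (auto intro!: frac_le)
  then have "Qf (log_kernel a k) z \<le> 2 * (1 - cmod (z $ k)) * (1 / (1 - cmod (z $ k)))"
    "Qf (log_kernel a k) z \<le> 2 * (1 - cmod (z $ k)) * (1 / (1 - cmod a))"
    unfolding Qf_log_kernel[OF a z] using w zk by - (rule mult_mono; simp)+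
  then show "Qf (log_kernel a k) z \<le> 2" "Qf (log_kernel a k) z \<le> 2 * (1 - cmod (z $ k)) / (1 - cmod a)"
    using zk by (simp_all del: right_diff_distrib_numeral)
qed

lemma log_kernel_in_bloch0:
  assumes a: "cmod a < 1"
  shows "log_kernel a k \<in> bloch0"
  unfolding bloch0_iff
proof (intro conjI allI impI)
  show "log_kernel a k \<in> bloch"
    by (rule blochI(1)[OF holo_log_kernel[OF a] Qf_log_kernel_le(1)[OF a]])
  fix \<epsilon> :: real assume \<epsilon>: "\<epsilon> > 0"
  define \<delta> where "\<delta> = min 1 (\<epsilon> * (1 - cmod a) / 2)"
  have "\<delta> > 0" "\<delta> \<le> 1" using \<epsilon> a by (auto simp: \<delta>_def)
  moreover have "Qf (log_kernel a k) z < \<epsilon>" if z: "z \<in> polydisk" and near: "\<forall>k. 1 - \<delta> < cmod (z $ k)" for z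
  proof -
    have "1 - cmod (z $ k) < \<epsilon> * (1 - cmod a) / 2"
      using near[rule_format, of k] by (auto simp: \<delta>_def)
    then have "2 * (1 - cmod (z $ k)) / (1 - cmod a) < \<epsilon>"
      using a by (simp add: field_simps)
    then show ?thesis using Qf_log_kernel_le(2)[OF a z, of k] by simp
  qed
  ultimately show "\<exists>\<delta>>0. \<delta> \<le> 1 \<and> (\<forall>z\<in>polydisk. (\<forall>k. 1 - \<delta> < cmod (z $ k)) \<longrightarrow> Qf (log_kernel a k) z < \<epsilon>)"
    by blast
qed

text \<open>Since (1+r)/(1-r) = (1+r)^2/(1-r^2), the two logarithms differ by 2 ln(1+r), which is at
  most 2.\<close>

lemma ln_ratio_le_log_kernel:
  assumes z: "z \<in> polydisk"
  shows "ln ((1 + cmod (z $ k)) / (1 - cmod (z $ k))) \<le> 2 + cmod (log_kernel (z $ k) k z)"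
proof -
  define r where "r = cmod (z $ k)"
  have r: "0 \<le> r" "r < 1" using z by (auto simp: r_def polydisk_def)
  have r2: "1 - r\<^sup>2 > 0" using polydisk_weight_pos[OF z] by (simp add: r_def)
  have "1 - cnj (z $ k) * z $ k = of_real (1 - r\<^sup>2)"
    by (simp add: r_def complex_norm_square mult.commute flip: of_real_power)
  then have K: "cmod (log_kernel (z $ k) k z) = \<bar>ln (1 - r\<^sup>2)\<bar>"
    using r2 by (simp add: log_kernel_def Ln_of_real del: of_real_diff of_real_power)
  have "1 - r\<^sup>2 = (1 + r) * (1 - r)"
    by (simp add: algebra_simps power2_eq_square)
  then have "ln ((1 + r) / (1 - r)) = 2 * ln (1 + r) - ln (1 - r\<^sup>2)"
    using r by (simp add: ln_div ln_mult)
  also have "\<dots> \<le> 2 + \<bar>ln (1 - r\<^sup>2)\<bar>"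
    using ln_add_one_self_le_self[OF r(1)] r by simp
  finally show ?thesis unfolding K unfolding r_def .
qed

text \<open>If \<open>C\<close> bounds the multiplication operator then $\|\psi^m\| \le C^m$, so that
  $|\psi(z)|^m$ is at most $C^m$ times a constant depending on $z$ only; hence $|\psi| \le C$.\<close>

lemma cmod_le_of_mult_bounded:
  fixes X :: "(complex ^ 'n \<Rightarrow> complex) set"
  assumes X: "X \<subseteq> bloch" "(\<lambda>_. 1) \<in> X"
    and mult: "\<And>f. f \<in> X \<Longrightarrow> (\<lambda>z. \<psi> z * f z) \<in> X"
    and C: "0 < C" "\<And>f. f \<in> X \<Longrightarrow> bloch_norm (\<lambda>z. \<psi> z * f z) \<le> C * bloch_norm f"
    and z: "z \<in> polydisk"
  shows "cmod (\<psi> z) \<le> C"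
proof (rule ccontr)
  assume "\<not> cmod (\<psi> z) \<le> C"
  then have "1 < cmod (\<psi> z) / C" using C(1) by simp
  then obtain m where m: "1 + log_sum z < (cmod (\<psi> z) / C) ^ m"
    using real_arch_pow by blast
  have pow: "(\<lambda>z. \<psi> z ^ m) \<in> X \<and> bloch_norm (\<lambda>z. \<psi> z ^ m) \<le> C ^ m" for m
  proof (induction m)
    case 0
    have "beta (\<lambda>_ :: complex ^ 'n. 1) \<le> 0"
      by (rule blochI(2)[OF holo_polydisk_const]) (simp add: Qf_const)
    then show ?case using X(2) by (simp add: bloch_norm_def)
  next
    case (Suc m)
    then have "bloch_norm (\<lambda>z. \<psi> z * \<psi> z ^ m) \<le> C * bloch_norm (\<lambda>z. \<psi> z ^ m)"
      by (intro C(2)) simp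
    also have "\<dots> \<le> C * C ^ m" using Suc C(1) by simp
    finally show ?case using mult[of "\<lambda>z. \<psi> z ^ m"] Suc by simp
  qed
  let ?f = "\<lambda>z. \<psi> z ^ m"
  have f: "?f \<in> bloch" using pow X(1) by blast
  have "cmod (?f z) \<le> cmod (?f 0) + beta ?f * log_sum z"
    by (rule bloch_growth[OF f z])
  also have "\<dots> \<le> (1 + log_sum z) * bloch_norm ?f"
    using log_sum_nonneg[OF z] beta_nonneg[OF f] by (simp add: bloch_norm_def algebra_simps)
  also have "\<dots> \<le> (1 + log_sum z) * C ^ m"
    using pow[of m] log_sum_nonneg[OF z] by (intro mult_left_mono) auto
  also have "\<dots> < (cmod (\<psi> z) / C) ^ m * C ^ m"
    using m C(1) by simp
  also have "\<dots> = cmod (?f z)"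
    using C(1) by (simp add: power_divide norm_power)
  finally show False by simp
qed

text \<open>All test functions, the constant 1 and the kernels, lie in \<open>bloch0\<close>, so one
  argument serves every \<open>X\<close> between the two spaces.\<close>

lemma mult_bounded_on_necessary:
  fixes X :: "(complex ^ 'n \<Rightarrow> complex) set"
  assumes \<psi>: "holo_polydisk \<psi>" and X: "X \<subseteq> bloch" "bloch0 \<subseteq> X" and bdd: "mult_bounded_on \<psi> X"
  shows "\<psi> \<in> Hinf" and "bdd_above ((\<lambda>z. log_sum z * Qf \<psi> z) ` polydisk)"
proof -
  obtain C0 where mult: "\<And>f. f \<in> X \<Longrightarrow> (\<lambda>z. \<psi> z * f z) \<in> X"
    and C0: "\<And>f. f \<in> X \<Longrightarrow> bloch_norm (\<lambda>z. \<psi> z * f z) \<le> C0 * bloch_norm f"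
    using bdd unfolding mult_bounded_on_def by blast
  \<comment> \<open>The iteration argument needs a positive constant, and \<open>C0\<close> may have
    any sign.\<close>
  define C where "C = max C0 1"
  have C: "bloch_norm (\<lambda>z. \<psi> z * f z) \<le> C * bloch_norm f" if "f \<in> X" for f
  proof -
    have "C0 * bloch_norm f \<le> C * bloch_norm f"
      using that X(1) bloch_norm_nonneg[of f] by (intro mult_right_mono) (auto simp: C_def)
    then show ?thesis using C0[OF that] by simp
  qed
  have Cpos: "0 < C" by (simp add: C_def)
  have M: "cmod (\<psi> z) \<le> C" if "z \<in> polydisk" for z
    using X const_in_bloch0 mult Cpos C that by (intro cmod_le_of_mult_bounded[of X]) auto
  then show "\<psi> \<in> Hinf"
    unfolding Hinf_def bounded_iff using \<psi> by auto
  \<comment> \<open>Per coordinate: the additive 2 of \<open>ln_ratio_le_log_kernel\<close> times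
    the Cauchy bound on \<open>Qf \<psi>\<close>, plus the kernel term \<open>4 * C\<close>, half of
    it from the operator bound and half from \<open>cmod (\<psi> z) * Qf ?f z\<close>.\<close>
  define B where "B = CARD('n) * (2 * (4 * C * CARD('n)) + 4 * C)"
  have "log_sum z * Qf \<psi> z \<le> B" if z: "z \<in> polydisk" for z
  proof -
    have "ln ((1 + cmod (z $ k)) / (1 - cmod (z $ k))) * Qf \<psi> z \<le> 2 * (4 * C * CARD('n)) + 4 * C" for k
    proof -
      \<comment> \<open>The kernel moves with the point: its parameter is the coordinate at which it
        is tested.\<close>
      let ?f = "log_kernel (z $ k) k"
      have a: "cmod (z $ k) < 1" using z by (simp add: polydisk_def)
      have fX: "?f \<in> X" using log_kernel_in_bloch0[OF a] X(2) by blast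
      have pX: "(\<lambda>z. \<psi> z * ?f z) \<in> bloch" using mult[OF fX] X(1) by blast
      have "bloch_norm ?f \<le> 2"
        using blochI(2)[OF holo_log_kernel[OF a] Qf_log_kernel_le(1)[OF a]] by (simp add: bloch_norm_def)
      then have "C * bloch_norm ?f \<le> C * 2"
        using Cpos by simp
      moreover have "Qf (\<lambda>z. \<psi> z * ?f z) z \<le> bloch_norm (\<lambda>z. \<psi> z * ?f z)"
        using Qf_le_beta[OF pX z] by (simp add: bloch_norm_def)
      moreover have "cmod (\<psi> z) * Qf ?f z \<le> C * 2"
        using M[OF z] Qf_log_kernel_le(1)[OF a z] Qf_nonneg[OF z] Cpos by (intro mult_mono) auto
      ultimately have 1: "cmod (?f z) * Qf \<psi> z \<le> 4 * C"
        using Qf_mult_ge[OF \<psi> holo_log_kernel[OF a] z, of k] C[OF fX] by linarith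
      have "ln ((1 + cmod (z $ k)) / (1 - cmod (z $ k))) * Qf \<psi> z \<le> (2 + cmod (?f z)) * Qf \<psi> z"
        using ln_ratio_le_log_kernel[OF z] Qf_nonneg[OF z] by (rule mult_right_mono)
      also have "\<dots> = 2 * Qf \<psi> z + cmod (?f z) * Qf \<psi> z"
        by (simp add: algebra_simps)
      also have "\<dots> \<le> 2 * (4 * C * CARD('n)) + 4 * C"
        using 1 Qf_le_of_bounded[OF \<psi> M z] by simp
      finally show ?thesis .
    qed
    then have "(\<Sum>k\<in>UNIV. ln ((1 + cmod (z $ k)) / (1 - cmod (z $ k))) * Qf \<psi> z)
        \<le> (\<Sum>k\<in>(UNIV::'n set). 2 * (4 * C * CARD('n)) + 4 * C)"
      by (intro sum_mono)
    then show ?thesis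
      by (simp add: log_sum_def sum_distrib_right B_def)
  qed
  then show "bdd_above ((\<lambda>z. log_sum z * Qf \<psi> z) ` polydisk)"
    by (rule bdd_aboveI2)
qed

theorem mainTheorem5:
  fixes \<psi> :: "complex ^ 'n \<Rightarrow> complex"
  assumes "holo_polydisk \<psi>"
  shows "(mult_bounded_on \<psi> (bloch :: (complex ^ 'n \<Rightarrow> complex) set)
            \<longleftrightarrow> mult_bounded_on \<psi> (bloch0 :: (complex ^ 'n \<Rightarrow> complex) set))
       \<and> (mult_bounded_on \<psi> (bloch0 :: (complex ^ 'n \<Rightarrow> complex) set)
            \<longleftrightarrow> (\<psi> \<in> Hinf \<and>
                 bdd_above ((\<lambda>z. (\<Sum>k\<in>UNIV. ln ((1 + cmod (z $ k)) / (1 - cmod (z $ k))))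
                                 * Qf \<psi> z) ` polydisk)))"
proof -
  let ?c = "\<psi> \<in> Hinf \<and> bdd_above ((\<lambda>z. log_sum z * Qf \<psi> z) ` polydisk)"
  have bloch: ?c if "mult_bounded_on \<psi> bloch"
    using mult_bounded_on_necessary[OF assms order_refl bloch0_subset_bloch that] ..
  have bloch0: ?c if "mult_bounded_on \<psi> bloch0"
    using mult_bounded_on_necessary[OF assms bloch0_subset_bloch order_refl that] ..
  have c: "mult_bounded_on \<psi> bloch \<and> mult_bounded_on \<psi> bloch0" if c: ?c
  proof -
    obtain M where M: "\<And>z. z \<in> polydisk \<Longrightarrow> cmod (\<psi> z) \<le> M"
      using c unfolding Hinf_def bounded_iff by auto
    obtain K where K: "\<And>z. z \<in> polydisk \<Longrightarrow> log_sum z * Qf \<psi> z \<le> K"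
      using c unfolding bdd_above_def by auto
    show ?thesis
      using mult_bounded_on_bloch[OF assms M K] mult_bounded_on_bloch0[OF assms M K] ..
  qed
  show ?thesis
    unfolding log_sum_def[symmetric] using bloch bloch0 c by iprover
qed

end
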